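(* Let $k,m\in\mathbb{N}=\{1,2,3,\ldots\}$ with $k<m$. Then there is a finite colouring of $\mathbb{R}$ such that there does not exist an uncountable set $X\subseteq\mathbb{R}$ with $FS_k(X)\cup FS_m(X)$ monochromatic.
   Context: For $X\subseteq\mathbb{R}$ and $k\in\mathbb{N}$, $FS_k(X)=\{\sum F: F\subseteq X,\ |F|=k\}$, the set of sums of $k$ distinct elements of $X$. A finite colouring of a set is a function on it with finite range; a set is monochromatic if the colouring is constant on it. *)

theory Defs
  imports "HOL-Analysis.Analysis"
begin

definition FS :: "nat \<Rightarrow> real set \<Rightarrow> real set" where
  "FS k X = {\<Sum>F | F. F \<subseteq> X \<and> finite F \<and> card F = k}"

definition finite_colouring :: "'a set \<Rightarrow> ('a \<Rightarrow> 'b) \<Rightarrow> bool" where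
  "finite_colouring A c \<longleftrightarrow> finite (c ` A)"

definition monochromatic :: "('a \<Rightarrow> 'b) \<Rightarrow> 'a set \<Rightarrow> bool" where
  "monochromatic c S \<longleftrightarrow> c constant_on S"

end

theory Submission
  imports Defs
begin

text \<open>
  Colour a real \<open>x\<close> by \<open>\<lfloor>log b \<bar>x\<bar>\<rfloor> mod 4\<close>, where \<open>b = sqrt (m / k)\<close>. An uncountable set has
  infinitely many elements of one sign in one of the countably many shells
  \<open>b powr n \<le> \<bar>x\<bar> < b powr (n + 1)\<close>. For these, \<open>log b\<close> of a sum of \<open>k\<close> elements and \<open>log b\<close> of a sum
  of \<open>m\<close> elements lie in two half-open unit intervals that are translates of each other by
  \<open>log b (m / k) = 2\<close>, so their floors differ by 1, 2 or 3.
\<close>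

text \<open>With a common sign no cancellation occurs, so \<bar>\<Sum>F\<bar> is the sum of the
  \<bar>x\<bar>, each of which lies in the shell from \<open>b powr n\<close> to
  \<open>b powr (n + 1)\<close>. Taking logarithms turns the factor \<open>card F\<close> into a
  shift.\<close>

lemma log_abs_sum_bounds:
  fixes F :: "real set" and b s :: real and n :: int
  assumes "1 < b" "finite F" "F \<noteq> {}" "s \<noteq> 0"
    and F: "\<And>x. x \<in> F \<Longrightarrow> sgn x = s \<and> \<lfloor>log b \<bar>x\<bar>\<rfloor> = n"
  shows "n + log b (card F) \<le> log b \<bar>\<Sum>F\<bar>" and "log b \<bar>\<Sum>F\<bar> < n + 1 + log b (card F)"
proof -
  have nz: "x \<noteq> 0" if "x \<in> F" for x
    using F[OF that] \<open>s \<noteq> 0\<close> by auto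
  have s1: "\<bar>s\<bar> = 1"
    using F \<open>F \<noteq> {}\<close> \<open>s \<noteq> 0\<close> by (metis abs_sgn_eq ex_in_conv sgn_zero)
  have "\<Sum>F = (\<Sum>x\<in>F. s * \<bar>x\<bar>)"
    using F by (intro sum.cong refl) (metis mult_sgn_abs)
  then have "\<Sum>F = s * (\<Sum>x\<in>F. \<bar>x\<bar>)"
    by (simp add: sum_distrib_left)
  then have abs_sum: "\<bar>\<Sum>F\<bar> = (\<Sum>x\<in>F. \<bar>x\<bar>)"
    using s1 by (simp add: abs_mult sum_nonneg)
  \<comment> \<open>The floor of the logarithm determines the shell only for a positive argument,
    hence the use of \<open>nz\<close>.\<close>
  have shell: "b powr n \<le> \<bar>x\<bar>" "\<bar>x\<bar> < b powr (n + 1)" if "x \<in> F" for x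
    using F[OF that] nz[OF that] \<open>1 < b\<close> floor_log_eq_powr_iff[of "\<bar>x\<bar>" b n] by auto
  have card_pos: "0 < real (card F)"
    using assms by (simp add: card_gt_0_iff)
  have lower: "card F * b powr n \<le> \<bar>\<Sum>F\<bar>"
    unfolding abs_sum by (intro sum_bounded_below shell)
  have "(\<Sum>x\<in>F. \<bar>x\<bar>) < (\<Sum>x\<in>F. b powr (n + 1))"
    using assms shell by (intro sum_strict_mono) auto
  then have upper: "\<bar>\<Sum>F\<bar> < card F * b powr (n + 1)"
    by (simp add: abs_sum)
  have pos: "0 < card F * b powr n"
    using card_pos \<open>1 < b\<close> by simp
  have "log b (card F * b powr n) \<le> log b \<bar>\<Sum>F\<bar>"
    using lower pos \<open>1 < b\<close> by (subst log_le_cancel_iff) auto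
  then show "n + log b (card F) \<le> log b \<bar>\<Sum>F\<bar>"
    using card_pos \<open>1 < b\<close> by (simp add: log_mult)
  have "log b \<bar>\<Sum>F\<bar> < log b (card F * b powr (n + 1))"
    using lower upper pos \<open>1 < b\<close> by (subst log_less_cancel_iff) auto
  then show "log b \<bar>\<Sum>F\<bar> < n + 1 + log b (card F)"
    using card_pos \<open>1 < b\<close> by (simp add: log_mult)
qed

text \<open>Otherwise \<open>X\<close> would be a countable union of finite fibres. An infinite
  fibre suffices later because it has finite subsets of every size.\<close>

lemma uncountable_imp_infinite_fibre:
  assumes "uncountable X" and "countable (f ` X)"
  obtains y where "infinite {x \<in> X. f x = y}"
proof (rule ccontr)
  assume "\<not> thesis"
  with that have "countable {x \<in> X. f x = y}" for y
    by (meson countable_finite)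
  then have "countable (\<Union>y\<in>f ` X. {x \<in> X. f x = y})"
    using assms(2) by blast
  moreover have "(\<Union>y\<in>f ` X. {x \<in> X. f x = y}) = X"
    by auto
  ultimately show False
    using assms(1) by simp
qed

theorem theorem1p2:
  fixes k m :: nat
  assumes "1 \<le> k" and "k < m"
  shows "\<exists>c :: real \<Rightarrow> nat. finite_colouring UNIV c \<and>
           \<not> (\<exists>X :: real set. uncountable X \<and> monochromatic c (FS k X \<union> FS m X))"
proof -
  \<comment> \<open>The square root makes the shift 2 rather than 1: with shift 1 the two unit
    intervals would be adjacent, and the floors could agree.\<close>
  define b where "b = sqrt (m / k)"
  have b: "1 < b"
    using assms by (simp add: b_def)
  have "log b m - log b k = log b (m / k)"
    using assms by (simp add: log_divide)
  also have "m / k = b ^ 2"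
    using assms by (simp add: b_def)
  also have "log b (b ^ 2) = 2"
    using b by (simp add: log_nat_power)
  finally have gap: "log b m = log b k + 2"
    by simp
  define c where "c x = nat (\<lfloor>log b \<bar>x\<bar>\<rfloor> mod 4)" for x :: real
  have "range c \<subseteq> {..<4}"
    by (auto simp: c_def nat_less_iff)
  then have "finite_colouring UNIV c"
    unfolding finite_colouring_def by (rule finite_subset) simp
  moreover have "\<not> monochromatic c (FS k X \<union> FS m X)" if "uncountable X" for X
  proof
    assume mono: "monochromatic c (FS k X \<union> FS m X)"
    define f :: "real \<Rightarrow> real \<times> int" where "f x = (sgn x, \<lfloor>log b \<bar>x\<bar>\<rfloor>)" for x
    have "f ` (X - {0}) \<subseteq> {-1, 0, 1} \<times> UNIV"
      by (auto simp: f_def sgn_if split: if_splits)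
    then have "countable (f ` (X - {0}))"
      by (rule countable_subset) (intro countable_SIGMA; simp)
    \<comment> \<open>Dropping 0 forces the common sign \<open>s\<close> to be nonzero.\<close>
    moreover have "uncountable (X - {0})"
      using that by (simp add: uncountable_minus_countable)
    ultimately obtain y where y: "infinite {x \<in> X - {0}. f x = y}"
      using uncountable_imp_infinite_fibre by blast
    obtain s n where sn: "y = (s, n)"
      by (cases y)
    define Y where "Y = {x \<in> X - {0}. f x = y}"
    have "infinite Y"
      using y by (simp add: Y_def)
    have "s \<noteq> 0"
      using infinite_imp_nonempty[OF y] sn by (auto simp: f_def sgn_zero_iff)
    have Y: "Y \<subseteq> X" "\<And>x. x \<in> Y \<Longrightarrow> sgn x = s \<and> \<lfloor>log b \<bar>x\<bar>\<rfloor> = n"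
      by (auto simp: Y_def f_def sn)
    obtain F where F: "F \<subseteq> Y" "finite F" "card F = k"
      using infinite_arbitrarily_large[OF \<open>infinite Y\<close>] by blast
    obtain G where G: "G \<subseteq> Y" "finite G" "card G = m"
      using infinite_arbitrarily_large[OF \<open>infinite Y\<close>] by blast
    have "\<Sum>F \<in> FS k X" "\<Sum>G \<in> FS m X"
      using F G Y(1) by (auto simp: FS_def)
    then have "c (\<Sum>F) = c (\<Sum>G)"
      using mono unfolding monochromatic_def constant_on_def by auto
    \<comment> \<open>Residues mod 4 are nonnegative, so \<open>nat\<close> loses nothing.\<close>
    then have mod_eq: "\<lfloor>log b \<bar>\<Sum>F\<bar>\<rfloor> mod 4 = \<lfloor>log b \<bar>\<Sum>G\<bar>\<rfloor> mod 4"
      by (simp add: c_def eq_nat_nat_iff)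
    have "F \<noteq> {}" "G \<noteq> {}"
      using F G assms by auto
    have "n + log b k \<le> log b \<bar>\<Sum>F\<bar>" "log b \<bar>\<Sum>F\<bar> < n + 1 + log b k"
      using log_abs_sum_bounds[OF b F(2) \<open>F \<noteq> {}\<close> \<open>s \<noteq> 0\<close>, of n] F Y(2) by auto
    moreover have "n + log b m \<le> log b \<bar>\<Sum>G\<bar>" "log b \<bar>\<Sum>G\<bar> < n + 1 + log b m"
      using log_abs_sum_bounds[OF b G(2) \<open>G \<noteq> {}\<close> \<open>s \<noteq> 0\<close>, of n] G Y(2) by auto
    \<comment> \<open>Intervals of length 1 at distance 2: the logarithms differ by more than 1 and
      less than 3. Shifts by integers commute with the floor, so the floors differ by 1, 2 or 3,
      never by a multiple of 4.\<close>
    ultimately have "log b \<bar>\<Sum>F\<bar> + 1 \<le> log b \<bar>\<Sum>G\<bar>" "log b \<bar>\<Sum>G\<bar> \<le> log b \<bar>\<Sum>F\<bar> + 3"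
      using gap by auto
    then have "\<lfloor>log b \<bar>\<Sum>F\<bar>\<rfloor> + 1 \<le> \<lfloor>log b \<bar>\<Sum>G\<bar>\<rfloor>" "\<lfloor>log b \<bar>\<Sum>G\<bar>\<rfloor> \<le> \<lfloor>log b \<bar>\<Sum>F\<bar>\<rfloor> + 3"
      by linarith+
    then show False
      using mod_eq by presburger
  qed
  ultimately show ?thesis
    by blast
qed

end
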